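(* Let $G$ be a finite simple connected graph of order $n$ which contains a cycle, and let $g$ be its girth (the length of a shortest cycle). Then for every integer $k\ge 0$, $\mu_k(G)\le n-g+2k+3$.
   Context: For $X\subseteq V(G)$ and an integer $k\ge 0$, two vertices $u,v\in V(G)$ are called $(X,k)$-visible if there exists a shortest $(u,v)$-path in $G$ having at most $k$ internal vertices that lie in $X$. A set $X\subseteq V(G)$ is a mutual $k$-visible set if every pair of distinct vertices of $X$ is $(X,k)$-visible. The mutual $k$-visibility number $\mu_k(G)$ is the maximum cardinality of a mutual $k$-visible set in $G$. *)

theory Defs
  imports "Graph_Theory.Graph_Theory"
begin

(* A finite simple graph is a G with "graph G" in the sense of Graph_Theory: a finite, loopless,
   symmetric digraph without parallel arcs, i.e. each undirected edge uv is represented by the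
   two arcs (u,v) and (v,u). Paths and cycles are lists of arcs, so "length" is the number of
   edges. *)

(* pre_digraph.cycle also accepts the closed walk u, v, u along the two arcs of a single edge.
   In a graph (no loops, no parallel arcs), these are the only ones of length less than 3, and the
   length bound excludes exactly them. *)
definition undirected_cycle :: "('a,'b) pre_digraph \<Rightarrow> 'b awalk \<Rightarrow> bool" where
  "undirected_cycle G p \<longleftrightarrow> pre_digraph.cycle G p \<and> 3 \<le> length p"

(* Only meaningful if G contains a cycle; otherwise the value is Inf {} = 0. *)
definition girth :: "('a,'b) pre_digraph \<Rightarrow> nat" where
  "girth G = Inf {length p | p. undirected_cycle G p}"

definition shortest_path :: "('a,'b) pre_digraph \<Rightarrow> 'a \<Rightarrow> 'b awalk \<Rightarrow> 'a \<Rightarrow> bool" where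
  "shortest_path G u p v \<longleftrightarrow> pre_digraph.apath G u p v \<and>
     (\<forall>q. pre_digraph.apath G u q v \<longrightarrow> length p \<le> length q)"

definition visible :: "('a,'b) pre_digraph \<Rightarrow> 'a set \<Rightarrow> nat \<Rightarrow> 'a \<Rightarrow> 'a \<Rightarrow> bool" where
  "visible G X k u v \<longleftrightarrow>
     (\<exists>p. shortest_path G u p v \<and> card (set (pre_digraph.inner_verts G p) \<inter> X) \<le> k)"

definition mutual_visible_set :: "('a,'b) pre_digraph \<Rightarrow> nat \<Rightarrow> 'a set \<Rightarrow> bool" where
  "mutual_visible_set G k X \<longleftrightarrow>
     X \<subseteq> verts G \<and> (\<forall>u\<in>X. \<forall>v\<in>X. u \<noteq> v \<longrightarrow> visible G X k u v)"

definition mutual_visibility_number :: "nat \<Rightarrow> ('a,'b) pre_digraph \<Rightarrow> nat" where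
  "mutual_visibility_number k G = Max {card X | X. mutual_visible_set G k X}"

end

theory Submission
  imports Defs
begin

text \<open>
  Two distinct paths between the same vertices contain a cycle, so their lengths add up to at least
  the girth g, and to more than g if they share an inner vertex. Hence a shortest path between two
  vertices of a cycle C of length g is an arc of C, unless its ends are antipodal on C and its
  g/2 - 1 inner vertices all avoid C.

  If a mutual k-visible set X is larger than claimed, then C contains at least 2k + 4 vertices of X.
  Fix u in X on C and let v be the (k+2)-nd vertex of X after u. Both arcs between u and v have more
  than k inner vertices in X, so u and v are antipodal and joined by a path avoiding C, on which some
  inner vertex is not in X. This vertex lies outside both C and X, which forces a (2k+5)-th vertex
  of X on C. The same argument then makes the (k+3)-rd vertex of X after u antipodal to u as well,
  which is absurd.
\<close>

section \<open>Splitting and counting in lists\<close>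

text \<open>Lets a cycle be cut at a vertex of \<open>X\<close> selected by the number of vertices
  of \<open>X\<close> before it.\<close>

lemma filter_nth_split:
  assumes "i < length (filter P xs)"
  obtains as v bs where "xs = as @ v # bs" "P v" "length (filter P as) = i"
proof -
  have "\<exists>as v bs. xs = as @ v # bs \<and> P v \<and> length (filter P as) = i"
    using assms
  proof (induction xs arbitrary: i)
    case Nil
    then show ?case by simp
  next
    case (Cons x xs)
    show ?case
    proof (cases "P x \<and> i = 0")
      case True
      then show ?thesis by (intro exI[of _ "[]"]) simp
    next
      case False
      define j where "j = (if P x then i - 1 else i)"
      have "j < length (filter P xs)"
        using Cons.prems False by (auto simp: j_def split: if_splits)
      from Cons.IH[OF this] obtain as v bs
        where "xs = as @ v # bs" "P v" "length (filter P as) = j" by blast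
      then show ?thesis
        using False by (intro exI[of _ "x # as"] exI[of _ v] exI[of _ bs]) (auto simp: j_def)
    qed
  qed
  then show ?thesis using that by blast
qed

lemma hd_butlast_tl_last:
  assumes "hd xs = x" "last xs = y" "2 \<le> length xs"
  shows "xs = x # butlast (tl xs) @ [y]"
proof -
  obtain zs where "xs = x # zs" using assms by (cases xs) auto
  then show ?thesis using assms by (cases zs rule: rev_cases) auto
qed

lemma length_filter_mem_distinct:
  "distinct xs \<Longrightarrow> length (filter (\<lambda>x. x \<in> X) xs) = card (set xs \<inter> X)"
  by (metis Int_commute distinct_card distinct_filter filter_set inter_set_filter)

section \<open>The girth as an attained minimum\<close>

lemma girth_le: "undirected_cycle G c \<Longrightarrow> girth G \<le> length c"
  unfolding girth_def by (rule cInf_lower) auto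

lemma girth_attained:
  assumes "undirected_cycle G c"
  obtains d where "undirected_cycle G d" "length d = girth G"
proof -
  have "girth G \<in> {length p | p. undirected_cycle G p}"
    unfolding girth_def by (rule Inf_nat_def1) (use assms in auto)
  then show ?thesis using that by auto
qed

section \<open>Reversing, splitting and rotating walks\<close>

text \<open>Symmetry supplies an opposite arc for every arc of \<open>p\<close>. These are other
  arcs than those of \<open>p\<close>, so the reversal is pinned down by its vertices and not as
  \<open>rev p\<close>.\<close>

lemma (in sym_digraph) awalk_reversal:
  assumes "awalk u p v"
  obtains q where "awalk v q u" "awalk_verts v q = rev (awalk_verts u p)"
proof -
  have "\<exists>q. awalk v q u \<and> awalk_verts v q = rev (awalk_verts u p)"
    using assms
  proof (induction p arbitrary: u)
    case Nil
    then show ?case by (intro exI[of _ "[]"]) (auto simp: awalk_Nil_iff)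
  next
    case (Cons e es)
    then have e: "e \<in> arcs G" "tail G e = u" "awalk (head G e) es v"
      by (auto simp: awalk_Cons_iff)
    from Cons.IH[OF e(3)] obtain q where q: "awalk v q (head G e)"
      "awalk_verts v q = rev (awalk_verts (head G e) es)" by blast
    obtain f where f: "f \<in> arcs G" "tail G f = head G e" "head G f = u"
      using sym_arcs e unfolding symmetric_conv by metis
    have w: "awalk v (q @ [f]) u"
      using q(1) f by (intro awalk_appendI[OF q(1)]) (auto simp: awalk_simps)
    have "awlast v q = head G e" using q(1) by blast
    then have "awalk_verts v (q @ [f]) = awalk_verts v q @ [u]"
      using awalk_verts_append[OF w] f by simp
    then show ?case using w q(2) e(2) by (intro exI[of _ "q @ [f]"]) simp
  qed
  then show ?thesis using that by blast
qed

context wf_digraph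
begin

lemma apath_split_at:
  assumes "apath u p v" "w \<in> set (awalk_verts u p)"
  obtains p1 p2 where "p = p1 @ p2" "apath u p1 w" "apath w p2 v"
proof -
  from assms obtain p1 p2 where p: "p = p1 @ p2" "awalk u p1 w"
    using awalk_decomp[of u p v w] unfolding apath_def by blast
  have "awlast u p1 = w" using p(2) by blast
  then show ?thesis
    using assms(1) p(1) that by (simp add: apath_append_iff)
qed

lemma apath_verts:
  assumes "apath u p v" "u \<noteq> v"
  shows "awalk_verts u p = u # inner_verts p @ [v]"
proof -
  have "hd (awalk_verts u p) = u" "last (awalk_verts u p) = v"
    using assms(1) unfolding apath_def by blast+
  moreover have "2 \<le> length (awalk_verts u p)"
    using assms by (cases p) (auto simp: length_awalk_verts apath_simps)
  ultimately show ?thesis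
    unfolding inner_verts_conv[of p u]
    by (rule hd_butlast_tl_last)
qed

text \<open>Rotation allows a shortest cycle to be based at a vertex of \<open>X\<close>.\<close>

lemma cycle_at_vertex:
  assumes "awalk u c u" "distinct (tl (awalk_verts u c))" "w \<in> set (awalk_verts u c)"
  obtains d where "awalk w d w" "distinct (tl (awalk_verts w d))" "length d = length c"
    "set (awalk_verts w d) = set (awalk_verts u c)"
proof -
  from rotate_awalkE[OF assms(1,3)] obtain q r where qr: "c = q @ r" "awalk w (r @ q) w"
    "set (awalk_verts w (r @ q)) = set (awalk_verts u c)" by blast
  \<comment> \<open>Apart from its first entry, the vertex list consists of the heads of the arcs;
    rotating the arcs only permutes these, so distinctness survives.\<close>
  have heads: "tl (awalk_verts x p) = map (head G) p" if "awalk x p y" for x p y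
    using that awalk_verts_conv'[of x p y] by (auto simp: awalk_def)
  have "distinct (tl (awalk_verts w (r @ q)))"
    using assms(2) heads[OF assms(1)] heads[OF qr(2)] qr(1) by auto
  with qr show ?thesis by (intro that[of "r @ q"]) auto
qed

end

section \<open>Cycles from pairs of paths\<close>

context graph
begin

text \<open>If the paths share an inner vertex, cut both there: the first pieces or the second
  pieces differ, and induction applies to them. Otherwise \<open>p\<close> followed by the reversal
  of \<open>q\<close> is a cycle.\<close>

lemma distinct_apaths_imp_cycle:
  assumes "apath u p v" "apath u q v" "p \<noteq> q"
  shows "\<exists>c. undirected_cycle G c \<and> length c \<le> length p + length q"
  using assms
proof (induction "length p" arbitrary: u p v q rule: less_induct)
  case less
  note p = less.prems(1) and q = less.prems(2)
  have ne: "p \<noteq> []" "q \<noteq> []" "u \<noteq> v"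
    using less.prems apath_ends[OF p p] apath_ends[OF q q] by auto
  show ?case
  proof (cases "\<exists>w. w \<in> set (awalk_verts u p) \<inter> set (awalk_verts u q) - {u, v}")
    case True
    then obtain w where w: "w \<in> set (awalk_verts u p)" "w \<in> set (awalk_verts u q)" "w \<noteq> u" "w \<noteq> v"
      by blast
    obtain p1 p2 where p12: "p = p1 @ p2" "apath u p1 w" "apath w p2 v"
      using apath_split_at[OF p w(1)] .
    obtain q1 q2 where q12: "q = q1 @ q2" "apath u q1 w" "apath w q2 v"
      using apath_split_at[OF q w(2)] .
    have "p1 \<noteq> []" "p2 \<noteq> []" using p12 w by (auto simp: apath_Nil_iff)
    then have len: "length p1 < length p" "length p2 < length p" using p12(1) by auto
    show ?thesis
    proof (cases "p1 = q1")
      case True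
      then have "p2 \<noteq> q2" using less.prems(3) p12 q12 by auto
      from less.hyps[OF len(2) p12(3) q12(3) this] show ?thesis
        using p12(1) q12(1) by fastforce
    next
      case False
      from less.hyps[OF len(1) p12(2) q12(2) this] show ?thesis
        using p12(1) q12(1) by fastforce
    qed
  next
    case False
    have pv: "awalk u p v" "distinct (awalk_verts u p)" "awalk u q v" "distinct (awalk_verts u q)"
      using p q by (auto simp: apath_def)
    obtain r where r: "awalk v r u" "awalk_verts v r = rev (awalk_verts u q)"
      using awalk_reversal[OF pv(3)] .
    have cw: "awalk u (p @ r) u" using pv(1) r(1) by (rule awalk_appendI)
    have "length (awalk_verts v r) = length (awalk_verts u q)" using r(2) by simp
    then have lr: "length r = length q" by (simp add: length_awalk_verts)
    have "awlast u p = v" using pv(1) by blast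
    then have vc: "tl (awalk_verts u (p @ r)) = (inner_verts p @ [v]) @ rev (inner_verts q) @ [u]"
      using awalk_verts_append[OF cw] r(2) apath_verts[OF p ne(3)] apath_verts[OF q ne(3)] by simp
    have "distinct (tl (awalk_verts u (p @ r)))"
      unfolding vc using False pv(2,4) ne(3)
      unfolding apath_verts[OF p ne(3)] apath_verts[OF q ne(3)] by auto
    \<comment> \<open>A shorter closed walk would come from two single arcs from \<open>u\<close> to
      \<open>v\<close>, which coincide because there are no parallel arcs.\<close>
    moreover have "3 \<le> length (p @ r)"
    proof (rule ccontr)
      assume "\<not> ?thesis"
      moreover have "length p \<ge> 1" "length q \<ge> 1" using ne by (simp_all add: Suc_le_eq)
      ultimately have "length p = 1" "length q = 1" using lr by simp_all
      then obtain a b where ab: "p = [a]" "q = [b]" by (auto simp: length_Suc_conv)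
      then have "a = b"
        using pv by (intro no_multi_arcs) (auto simp: awalk_simps arc_to_ends_def)
      then show False using ab less.prems(3) by simp
    qed
    ultimately have "undirected_cycle G (p @ r)"
      using cw ne unfolding undirected_cycle_def cycle_def by blast
    then show ?thesis using lr by (intro exI[of _ "p @ r"]) simp
  qed
qed

lemma girth_le_distinct_apaths:
  assumes "apath u p v" "apath u q v" "p \<noteq> q"
  shows "girth G \<le> length p + length q"
  using distinct_apaths_imp_cycle[OF assms] girth_le le_trans by blast

text \<open>Cut at \<open>w\<close>, the paths differ in their first or in their second pieces, and
  the lengths of such a differing pair already add up to the girth. The remaining piece of
  \<open>p\<close> is nonempty, which makes the bound strict.\<close>

lemma girth_less_crossing_apaths:
  assumes p: "apath u p v" and q: "apath u q v" and "p \<noteq> q"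
    and w: "w \<in> set (awalk_verts u p)" "w \<in> set (awalk_verts u q)" "w \<noteq> u" "w \<noteq> v"
  shows "girth G < length p + length q"
proof -
  obtain p1 p2 where p12: "p = p1 @ p2" "apath u p1 w" "apath w p2 v"
    using apath_split_at[OF p w(1)] .
  obtain q1 q2 where q12: "q = q1 @ q2" "apath u q1 w" "apath w q2 v"
    using apath_split_at[OF q w(2)] .
  have "p1 \<noteq> []" "p2 \<noteq> []" using p12 w by (auto simp: apath_Nil_iff)
  then have len: "0 < length p1" "0 < length p2" by auto
  show ?thesis
  proof (cases "p1 = q1")
    case True
    then have "p2 \<noteq> q2" using \<open>p \<noteq> q\<close> p12 q12 by auto
    from girth_le_distinct_apaths[OF p12(3) q12(3) this] show ?thesis
      unfolding p12(1) q12(1) length_append using len by linarith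
  next
    case False
    from girth_le_distinct_apaths[OF p12(2) q12(2) this] show ?thesis
      unfolding p12(1) q12(1) length_append using len by linarith
  qed
qed

section \<open>Visibility between vertices of a shortest cycle\<close>

text \<open>Here \<open>a\<close> and \<open>b\<close> play the two arcs of a shortest cycle. A
  third path \<open>p\<close> satisfies
  \<open>length p + length a \<ge> length a + length b\<close>, hence is at least as long as
  \<open>b\<close>, and likewise as \<open>a\<close>. Being shortest, it has the length of both; the
  sums then equal the girth exactly, so the strict bound for crossing paths forbids shared inner
  vertices.\<close>

lemma shortest_path_of_girth_cycle:
  assumes "u \<noteq> v" and a: "apath u a v" and b: "apath u b v" and g: "length a + length b = girth G"
    and p: "shortest_path G u p v"
  shows "p = a \<or> p = b \<or>
    length p = length a \<and> length p = length b \<and>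
    set (inner_verts p) \<inter> (set (awalk_verts u a) \<union> set (awalk_verts u b)) = {}"
proof (cases "p = a \<or> p = b")
  case False
  then have ne: "p \<noteq> a" "p \<noteq> b" by auto
  have pa: "apath u p v" and le: "length p \<le> length a" "length p \<le> length b"
    using p a b unfolding shortest_path_def by auto
  have eq: "length p = length a" "length p = length b"
    using girth_le_distinct_apaths[OF pa a ne(1)] girth_le_distinct_apaths[OF pa b ne(2)] g le
    by linarith+
  have "False" if x: "x \<in> set (inner_verts p)"
    "x \<in> set (awalk_verts u a) \<or> x \<in> set (awalk_verts u b)" for x
  proof -
    have "x \<in> set (awalk_verts u p)" "x \<noteq> u" "x \<noteq> v"
      using x(1) set_inner_verts[OF pa] by auto
    then show False
      using girth_less_crossing_apaths[OF pa a ne(1)] girth_less_crossing_apaths[OF pa b ne(2)]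
        x(2) eq g by (metis less_irrefl)
  qed
  then show ?thesis using eq by blast
qed blast

text \<open>
  The first conclusion says that the vertex of X reached after passing i others is antipodal to u.
\<close>

lemma girth_cycle_antipodal:
  assumes c: "awalk u c u" "distinct (tl (awalk_verts u c))" "length c = girth G"
    and X: "mutual_visible_set G k X" "u \<in> X"
    and i: "k + 1 \<le> i" "i + k + 2 \<le> length (filter (\<lambda>x. x \<in> X) (inner_verts c))"
  shows "length (filter (\<lambda>x. x \<in> X) (take (girth G div 2 - 1) (inner_verts c))) = i"
    and "\<not> verts G \<subseteq> set (awalk_verts u c) \<union> X"
proof -
  let ?f = "\<lambda>xs. length (filter (\<lambda>x. x \<in> X) xs)"
  have "i < ?f (inner_verts c)" using i by simp
  then obtain as v bs where ws: "inner_verts c = as @ v # bs" "v \<in> X" "?f as = i"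
    by (rule filter_nth_split)
  have "c \<noteq> []" using ws(1) by auto
  have ends: "hd (awalk_verts u c) = u" "last (awalk_verts u c) = u" using c(1) by blast+
  have vc: "awalk_verts u c = u # as @ v # bs @ [u]"
  proof -
    have "2 \<le> length (awalk_verts u c)"
      using \<open>c \<noteq> []\<close> by (cases c) (auto simp: length_awalk_verts)
    from hd_butlast_tl_last[OF ends this] show ?thesis
      using ws(1) unfolding inner_verts_conv[of c u] by simp
  qed
  have dist: "distinct (as @ v # bs @ [u])" using c(2) vc by simp
  have cc: "cas u c u" using c(1) by blast
  obtain a r where ar: "cas u a v" "cas v r u" "c = a @ r"
    "awalk_verts u a = u # as @ [v]" "awalk_verts v r = v # bs @ [u]"
    by (rule awalk_decomp_verts[OF cc, of "u # as" v "bs @ [u]"]) (use vc in auto)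
  have "awlast u a = v" using ar(1) by (rule awlast_if_cas)
  then have aw: "awalk u a v" "awalk v r u" using c(1) unfolding ar(3) by simp_all
  \<comment> \<open>The second arc of the cycle is reversed so that both arcs run from
    \<open>u\<close> to \<open>v\<close>.\<close>
  obtain b where b: "awalk u b v" "awalk_verts u b = rev (awalk_verts v r)"
    using awalk_reversal[OF aw(2)] .
  have apa: "apath u a v" and apb: "apath u b v"
    using aw b dist ar by (auto simp: apath_def)
  have "u \<noteq> v" using dist by auto
  have la: "length a = length as + 1" using length_awalk_verts[of u a] ar(4) by simp
  have lb: "length b = length bs + 1" using length_awalk_verts[of u b] b(2) ar(5) by simp
  have "length c = length as + length bs + 2" using length_awalk_verts[of u c] vc by simp
  then have g: "length a + length b = girth G" using la lb c(3) by simp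
  have ina: "inner_verts a = as" unfolding inner_verts_conv[of a u] using ar(4) by simp
  have inb: "inner_verts b = rev bs" unfolding inner_verts_conv[of b u] using b(2) ar(5) by simp
  obtain p where p: "shortest_path G u p v" "card (set (inner_verts p) \<inter> X) \<le> k"
    using X ws(2) \<open>u \<noteq> v\<close> unfolding mutual_visible_set_def visible_def by blast
  \<comment> \<open>Of the at least \<open>i + k + 2\<close> vertices of \<open>X\<close>,
    \<open>i\<close> lie before \<open>v\<close> and one is \<open>v\<close> itself.\<close>
  have "?f bs \<ge> k + 1" using i ws by simp
  then have "card (set bs \<inter> X) > k" "card (set as \<inter> X) > k"
    using dist length_filter_mem_distinct[of as X] length_filter_mem_distinct[of bs X] ws(3) i(1) by auto
  then have "p \<noteq> a" "p \<noteq> b" using p(2) ina inb by auto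
  then have eq: "length p = length a" "length p = length b"
    and disj: "set (inner_verts p) \<inter> (set (awalk_verts u a) \<union> set (awalk_verts u b)) = {}"
    using shortest_path_of_girth_cycle[OF \<open>u \<noteq> v\<close> apa apb g p(1)] by auto
  \<comment> \<open>Both arcs have half the girth as length, so \<open>as\<close> is a prefix whose
    length does not depend on \<open>i\<close>. This is what makes different values of
    \<open>i\<close> incompatible.\<close>
  have "girth G div 2 - 1 = length as" using eq g la by linarith
  then show "?f (take (girth G div 2 - 1) (inner_verts c)) = i" using ws by simp
  have app: "apath u p v" using p(1) unfolding shortest_path_def by simp
  \<comment> \<open>The path \<open>p\<close> has as many inner vertices as \<open>a\<close>, at
    least \<open>k + 1\<close>, but at most \<open>k\<close> of them lie in \<open>X\<close>. One
    that does not is also off the cycle.\<close>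
  have "distinct (inner_verts p)" using apath_verts[OF app \<open>u \<noteq> v\<close>] app by (simp add: apath_def)
  moreover have "length (inner_verts p) = length as"
    using arg_cong[OF apath_verts[OF app \<open>u \<noteq> v\<close>], of length] eq la by (simp add: length_awalk_verts)
  moreover have "length as \<ge> k + 1" using ws(3) i(1) length_filter_le[of "\<lambda>x. x \<in> X" as] by linarith
  ultimately have "card (set (inner_verts p)) > k" by (simp add: distinct_card)
  then have "\<not> set (inner_verts p) \<subseteq> X" using p(2) by (metis Int_absorb2 not_le)
  moreover have "set (inner_verts p) \<subseteq> verts G"
    using app set_inner_verts[OF app] unfolding apath_def by blast
  moreover have "set (awalk_verts u c) = set (awalk_verts u a) \<union> set (awalk_verts u b)"
    using vc ar b by auto
  ultimately show "\<not> verts G \<subseteq> set (awalk_verts u c) \<union> X" using disj by blast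
qed

text \<open>Counts \<open>X\<close> separately on a shortest cycle and off it. The additive form
  avoids truncated subtraction.\<close>

lemma mutual_visible_set_card_le:
  assumes X: "mutual_visible_set G k X" and cyc: "undirected_cycle G c0"
  shows "card X + girth G \<le> card (verts G) + 2 * k + 3"
proof (rule ccontr)
  assume "\<not> ?thesis"
  then have big: "card (verts G) + 2 * k + 4 \<le> card X + girth G" by simp
  obtain c1 where c1: "undirected_cycle G c1" "length c1 = girth G"
    using girth_attained[OF cyc] .
  then obtain u1 where u1: "awalk u1 c1 u1" "distinct (tl (awalk_verts u1 c1))" "c1 \<noteq> []"
    unfolding undirected_cycle_def cycle_def by blast
  define S where "S = set (awalk_verts u1 c1)"
  have S: "S \<subseteq> verts G" using u1(1) unfolding S_def by blast
  have XV: "X \<subseteq> verts G" using X unfolding mutual_visible_set_def by simp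
  have fin: "finite X" "finite S" using XV S finite_subset finite_verts by blast+
  have "last (awalk_verts u1 c1) = u1" "hd (awalk_verts u1 c1) = u1" using u1(1) by blast+
  \<comment> \<open>The base vertex occurs again at the end, so dropping its first occurrence loses
    no vertex.\<close>
  then have "S = set (tl (awalk_verts u1 c1))"
    using u1(3) length_awalk_verts[of u1 c1] unfolding S_def
    by (cases "awalk_verts u1 c1") (auto split: if_splits)
  then have cS: "card S = girth G"
    using u1(2) c1(2) by (simp add: distinct_card length_awalk_verts)
  have cV: "card (verts G) = card S + card (verts G - S)"
    using S fin by (simp add: card_Diff_subset card_mono)
  have cX: "card X = card (X \<inter> S) + card (X - S)" using fin(1) by (metis card_Int_Diff)
  have cO: "card (X - S) \<le> card (verts G - S)" using XV by (intro card_mono) auto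
  \<comment> \<open>At most \<open>card (verts G) - girth G\<close> vertices of \<open>X\<close> lie
    off the cycle.\<close>
  have j: "2 * k + 4 \<le> card (X \<inter> S)" using big cS cV cX cO by simp
  then obtain u where u: "u \<in> X" "u \<in> S" by (metis IntE card.empty ex_in_conv not_numeral_le_zero add_leD2)
  obtain c where c: "awalk u c u" "distinct (tl (awalk_verts u c))" "length c = girth G"
    "set (awalk_verts u c) = S"
    using cycle_at_vertex[OF u1(1,2)] u(2) c1(2) unfolding S_def by metis
  have "hd (awalk_verts u c) = u" "last (awalk_verts u c) = u" using c(1) by blast+
  moreover have "length (awalk_verts u c) \<ge> 2"
    using c(3) c1 by (simp add: length_awalk_verts undirected_cycle_def)
  ultimately have vc: "awalk_verts u c = u # inner_verts c @ [u]"
    unfolding inner_verts_conv[of c u]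
    by (rule hd_butlast_tl_last)
  have "distinct (inner_verts c)" "S = insert u (set (inner_verts c))" "u \<notin> set (inner_verts c)"
    using c(2,4) vc by auto
  then have f: "length (filter (\<lambda>x. x \<in> X) (inner_verts c)) + 1 = card (X \<inter> S)"
    using u(1) by (simp add: length_filter_mem_distinct Int_commute)
  note antip = girth_cycle_antipodal[OF c(1,2,3) X u(1)]
  \<comment> \<open>For \<open>i = k + 1\<close> the required number is \<open>2k + 3\<close>, which
    is available since \<open>f\<close> leaves out only \<open>u\<close>.\<close>
  have "\<not> verts G \<subseteq> S \<union> X" using antip(2)[of "k + 1"] f j c(4) by simp
  then obtain x where "x \<in> verts G - S" "x \<notin> X" by blast
  \<comment> \<open>The vertex \<open>x\<close> makes the bound on \<open>X\<close> off the cycle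
    strict, which gains one more vertex of \<open>X\<close> on it.\<close>
  then have "X - S \<subset> verts G - S" using XV by blast
  then have "card (X - S) < card (verts G - S)" by (intro psubset_card_mono) auto
  then have "2 * k + 5 \<le> card (X \<inter> S)" using big cS cV cX by simp
  \<comment> \<open>Now \<open>i = k + 2\<close> is admissible too, and the same prefix would
    contain both \<open>k + 1\<close> and \<open>k + 2\<close> vertices of \<open>X\<close>.\<close>
  then show False using antip(1)[of "k + 1"] antip(1)[of "k + 2"] f by simp
qed

end

theorem theorem3p9:
  fixes G :: "('a, 'b) pre_digraph" and k :: nat
  assumes "Digraph.graph G"
    and "Digraph_Component.connected G"
    and "\<exists>p. undirected_cycle G p"
  shows "int (mutual_visibility_number k G)
           \<le> int (card (verts G)) - int (girth G) + 2 * int k + 3"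
proof -
  interpret graph G by fact
  let ?M = "{card X | X. mutual_visible_set G k X}"
  \<comment> \<open>\<open>Max\<close> is meaningful only on a finite nonempty set; the empty set of
    vertices is a witness for nonemptiness.\<close>
  have "?M \<subseteq> card ` Pow (verts G)" by (auto simp: mutual_visible_set_def)
  then have "finite ?M" by (rule finite_subset) simp
  moreover have "card {} \<in> ?M" by (intro CollectI exI[of _ "{}"]) (simp add: mutual_visible_set_def)
  ultimately have "Max ?M \<in> ?M" by (intro Max_in) auto
  then obtain X where "mutual_visible_set G k X" "mutual_visibility_number k G = card X"
    unfolding mutual_visibility_number_def by auto
  then show ?thesis using mutual_visible_set_card_le assms(3) by fastforce
qed

end
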